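(* Let $x\in[D]^T$ be a document of length $T$, let $S\subseteq[T]$, and let $\tilde x\in B_S(x)$. Let $m_{\max}=\max_{j\in[D]} m_j(x)$ be the maximal word multiplicity in $x$ and let $v_{\max}=\max_{j\in[D]}v_j$ be the maximal inverse document frequency over the dictionary. Let $\varphi$ be the (non-normalized) TF-IDF transform. Then $$\|\varphi(x)-\varphi(\tilde x)\|\le 4\,m_{\max}\,v_{\max}\,\frac{|S|}{T}.$$
   Context: Notation: $\|\cdot\|$ is the Euclidean norm, $[n]=\{1,\dots,n\}$. The dictionary of words is $[D]$, and a document of length $T\geq 1$ is an element $x=(x_1,\dots,x_T)\in[D]^T$. For $x\in[D]^T$ and $S\subseteq[T]$, $B_S(x)=\{\tilde x\in[D]^T:\tilde x_t=x_t\text{ for all }t\notin S\}$. TF-IDF: $m_j(x)=|\{t\in[T]:x_t=j\}|$ is the multiplicity of word $j$ in $x$. A fixed finite set (corpus) $\mathcal C$ of documents is given, and $v_j=\log\frac{|\mathcal C|}{|\{z\in\mathcal C: j\in z\}|}$ is the inverse document frequency of $j$; it is assumed that $v_j$ is well defined (finite) and $v_j>0$ for every $j\in[D]$. The non-normalized TF-IDF of $x\in[D]^T$ is the vector $\varphi(x)\in\mathbb{R}^D$ with coordinates $\varphi(x)_j=\frac{m_j(x)}{T}v_j$. *)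

theory Defs
  imports "HOL-Analysis.Analysis"
begin

text \<open>
  The dictionary \<open>[D]\<close> is an arbitrary finite type \<open>'w\<close> with \<open>D = CARD('w)\<close>, so that
  \<open>real ^ 'w\<close> with its library \<open>norm\<close> is Euclidean space of dimension \<open>D\<close>.  A document of
  length \<open>T\<close> is a list of words of length \<open>T\<close> (lists, because the corpus may contain
  documents of different lengths); positions are numbered \<open>0, \<dots>, T - 1\<close>.
\<close>

definition perturbations :: "nat set \<Rightarrow> 'w list \<Rightarrow> 'w list set" where
  "perturbations S x =
     {y. length y = length x \<and> (\<forall>t<length x. t \<notin> S \<longrightarrow> y ! t = x ! t)}"

definition multiplicity_in :: "'w list \<Rightarrow> 'w \<Rightarrow> nat" where
  "multiplicity_in x j = card {t. t < length x \<and> x ! t = j}"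

definition idf :: "'w list set \<Rightarrow> 'w \<Rightarrow> real" where
  "idf C j = ln (real (card C) / real (card {z \<in> C. j \<in> set z}))"

definition tfidf :: "'w::finite list set \<Rightarrow> 'w list \<Rightarrow> real ^ 'w" where
  "tfidf C x = (\<chi> j. real (multiplicity_in x j) / real (length x) * idf C j)"

definition max_multiplicity :: "'w::finite list \<Rightarrow> nat" where
  "max_multiplicity x = Max (range (multiplicity_in x))"

definition max_idf :: "'w::finite list set \<Rightarrow> real" where
  "max_idf C = Max (range (idf C))"

end

theory Submission
  imports Defs
begin

text \<open>
  The Euclidean norm is at most the \<open>\<ell>\<^sup>1\<close> norm, and changing one word of a document changes the
  multiplicity vector by at most \<open>2\<close> in \<open>\<ell>\<^sup>1\<close>.  This gives the bound with constant
  \<open>2 v\<^sub>m\<^sub>a\<^sub>x\<close>, which is stronger because some word occurs, so that \<open>m\<^sub>m\<^sub>a\<^sub>x \<ge> 1\<close>.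
\<close>

text \<open>Counting by indicators of positions lets two documents be compared position by position
  and lets sums over words and positions be interchanged.\<close>

lemma multiplicity_in_eq_sum:
  "real (multiplicity_in x j) = (\<Sum>t<length x. of_bool (x ! t = j))"
proof -
  have "{t. t < length x \<and> x ! t = j} = {..<length x} \<inter> {t. x ! t = j}"
    by auto
  then show ?thesis
    by (simp add: multiplicity_in_def)
qed

lemma sum_abs_multiplicity_in_diff_le:
  fixes x y :: "'w::finite list"
  assumes "S \<subseteq> {..<length x}" and "y \<in> perturbations S x"
  shows "(\<Sum>j\<in>UNIV. \<bar>real (multiplicity_in x j) - real (multiplicity_in y j)\<bar>) \<le> 2 * real (card S)"
proof -
  have len: "length y = length x"
    and eq: "\<And>t. t < length x \<Longrightarrow> t \<notin> S \<Longrightarrow> y ! t = x ! t"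
    using assms(2) by (auto simp: perturbations_def)
  let ?d = "\<lambda>j t. of_bool (x ! t = j) - of_bool (y ! t = j) :: real"
  have "\<bar>real (multiplicity_in x j) - real (multiplicity_in y j)\<bar>
      \<le> (\<Sum>t\<in>S. of_bool (x ! t = j) + of_bool (y ! t = j))" for j
  proof -
    have "real (multiplicity_in x j) - real (multiplicity_in y j) = (\<Sum>t<length x. ?d j t)"
      by (simp only: multiplicity_in_eq_sum len sum_subtractf)
    \<comment> \<open>Outside \<open>S\<close> the two documents agree, so those indicators
      cancel.\<close>
    also have "\<dots> = (\<Sum>t\<in>S. ?d j t)"
      using assms(1) eq by (intro sum.mono_neutral_right) auto
    finally have "\<bar>real (multiplicity_in x j) - real (multiplicity_in y j)\<bar> \<le> (\<Sum>t\<in>S. \<bar>?d j t\<bar>)"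
      by simp
    \<comment> \<open>The difference of indicators is replaced by their sum, which is easy to total
      over all words \<open>j\<close>.\<close>
    also have "\<dots> \<le> (\<Sum>t\<in>S. of_bool (x ! t = j) + of_bool (y ! t = j))"
      by (intro sum_mono) auto
    finally show ?thesis .
  qed
  then have "(\<Sum>j\<in>UNIV. \<bar>real (multiplicity_in x j) - real (multiplicity_in y j)\<bar>)
      \<le> (\<Sum>j\<in>UNIV. \<Sum>t\<in>S. of_bool (x ! t = j) + of_bool (y ! t = j))"
    by (intro sum_mono)
  also have "\<dots> = (\<Sum>t\<in>S. \<Sum>j\<in>UNIV. of_bool (x ! t = j) + of_bool (y ! t = j))"
    by (rule sum.swap)
  \<comment> \<open>For a fixed position \<open>t\<close>, exactly one word equals
    \<open>x ! t\<close> and exactly one equals \<open>y ! t\<close>: each \<open>t\<close>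
    contributes 1 + 1.\<close>
  also have "\<dots> = 2 * real (card S)"
    by (simp add: sum.distrib)
  finally show ?thesis .
qed

lemma max_multiplicity_pos:
  assumes "x \<noteq> []"
  shows "max_multiplicity x \<ge> 1"
proof -
  have "multiplicity_in x (x ! 0) > 0"
    using assms by (auto simp: multiplicity_in_def card_gt_0_iff)
  also have "multiplicity_in x (x ! 0) \<le> max_multiplicity x"
    by (simp add: max_multiplicity_def)
  finally show ?thesis by simp
qed

lemma idf_le_max_idf: "idf C j \<le> max_idf C"
  by (simp add: max_idf_def)

lemma norm_tfidf_diff_le:
  assumes "\<And>j. idf C j \<ge> 0" and "S \<subseteq> {..<length x}" and "y \<in> perturbations S x"
  shows "norm (tfidf C x - tfidf C y) \<le> 2 * max_idf C * (real (card S) / real (length x))"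
proof -
  let ?\<delta> = "\<lambda>j. \<bar>real (multiplicity_in x j) - real (multiplicity_in y j)\<bar>"
  \<comment> \<open>Equal lengths give both term frequencies the same denominator, so each
    coordinate of the difference is a scaled difference of multiplicities.\<close>
  have "length y = length x"
    using assms(3) by (simp add: perturbations_def)
  then have coord: "(tfidf C x - tfidf C y) $ j
      = (real (multiplicity_in x j) - real (multiplicity_in y j)) / real (length x) * idf C j" for j
    by (simp add: tfidf_def left_diff_distrib diff_divide_distrib)
  have "norm (tfidf C x - tfidf C y) \<le> (\<Sum>j\<in>UNIV. \<bar>(tfidf C x - tfidf C y) $ j\<bar>)"
    by (rule norm_le_l1_cart)
  also have "\<dots> = (\<Sum>j\<in>UNIV. ?\<delta> j / real (length x) * idf C j)"
    using assms(1) by (simp only: coord abs_mult abs_divide abs_of_nat abs_of_nonneg)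
  also have "\<dots> \<le> (\<Sum>j\<in>UNIV. ?\<delta> j / real (length x) * max_idf C)"
    by (intro sum_mono mult_left_mono idf_le_max_idf) simp
  also have "\<dots> = (\<Sum>j\<in>UNIV. ?\<delta> j) / real (length x) * max_idf C"
    by (simp add: sum_distrib_right sum_divide_distrib)
  also have "\<dots> \<le> 2 * real (card S) / real (length x) * max_idf C"
    \<comment> \<open>\<open>max_idf C\<close> is nonnegative because it dominates a nonnegative
      \<open>idf\<close>; this allows multiplying the \<open>\<ell>\<^sup>1\<close> bound by
      it.\<close>
    using order_trans[OF assms(1) idf_le_max_idf]
    by (intro mult_right_mono divide_right_mono sum_abs_multiplicity_in_diff_le assms) auto
  finally show ?thesis
    by (simp add: mult_ac)
qed

theorem proposition4p1:
  fixes C :: "'w::finite list set"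
    and x y :: "'w list"
    and S :: "nat set"
    and T :: nat
  assumes "finite C"
    and "\<And>z. z \<in> C \<Longrightarrow> length z \<ge> 1"
    and "\<And>j. \<exists>z\<in>C. j \<in> set z"
    and "\<And>j. idf C j > 0"
    and "T \<ge> 1"
    and "length x = T"
    and "S \<subseteq> {..<T}"
    and "y \<in> perturbations S x"
  shows "norm (tfidf C x - tfidf C y)
    \<le> 4 * real (max_multiplicity x) * max_idf C * (real (card S) / real T)"
proof -
  have nonneg: "idf C j \<ge> 0" for j
    using assms(4) by (simp add: less_imp_le)
  have "norm (tfidf C x - tfidf C y) \<le> 2 * max_idf C * (real (card S) / real T)"
    using norm_tfidf_diff_le[OF nonneg _ assms(8)] assms(6,7) by simp
  also have "\<dots> \<le> 4 * real (max_multiplicity x) * max_idf C * (real (card S) / real T)"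
  \<comment> \<open>Only the leading constants differ, and the remaining factors are nonnegative.
    Since \<open>T \<ge> 1\<close> makes \<open>x\<close> nonempty, its maximal multiplicity is at
    least 1.\<close>
  proof (intro mult_right_mono)
    have "x \<noteq> []"
      using assms(5,6) by auto
    then show "2 \<le> 4 * real (max_multiplicity x)"
      using max_multiplicity_pos[of x] by simp
    show "0 \<le> max_idf C"
      using order_trans[OF nonneg idf_le_max_idf] .
  qed simp
  finally show ?thesis .
qed

end
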